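(* Let $A$, $B$ and $C$ be three rings, with $B$ and $C$ commutative. Let $g:A\to B$ and $f:B\to C$ be two central $\mathbb{Z}$-linear maps. Let $h:=f\circ g:A\to C$. Let $n\in\mathbb{N}$ and $a_1,a_2,\ldots,a_n\in A$. For any subset $P=\{p_1,p_2,\ldots,p_r\}$ of $[n]$ (with $p_1,\ldots,p_r$ distinct), set $$b_P:=g_r(a_{p_1},a_{p_2},\ldots,a_{p_r})\in B$$ (this does not depend on the order in which the elements of $P$ are labelled, since $g_r$ is symmetric). Then $$h_n(a_1,a_2,\ldots,a_n)=\sum_{\pi=\{P_1,P_2,\ldots,P_k\}\in\Pi_{[n]}}f_k(b_{P_1},b_{P_2},\ldots,b_{P_k}),$$ where $P_1,\ldots,P_k$ are the distinct blocks of $\pi$ (each addend does not depend on the order in which the blocks are labelled, since $f_k$ is symmetric).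
   Context: Rings are associative and unital, not necessarily commutative. $\mathbb{N}=\{0,1,2,\ldots\}$, $[n]=\{1,2,\ldots,n\}$, and $S_n$ is the group of permutations of $[n]$; $(-1)^\sigma$ is the sign of $\sigma$. A cycle of a permutation $\sigma$ is a tuple $(i_1,\ldots,i_k)$ of distinct elements with $\sigma(i_j)=i_{j+1}$ for $j<k$ and $\sigma(i_k)=i_1$, considered up to cyclic rotation; fixed points count as $1$-cycles. Let $A$ be a ring, $B$ a commutative ring, and $f:A\to B$ a $\mathbb{Z}$-linear map (not required to be unital or multiplicative). We say $f$ is central if $f(aa')=f(a'a)$ for all $a,a'\in A$. If $f$ is central and $n\in\mathbb{N}$, the $n$-Frobenius map of $f$ is the $\mathbb{Z}$-multilinear map $f_n:A^n\to B$ given by $$f_n(a_1,\ldots,a_n)=\sum_{\sigma\in S_n}(-1)^\sigma\prod_{\substack{c=(i_1,i_2,\ldots,i_k)\\ \text{is a cycle of }\sigma}}f(a_{i_1}a_{i_2}\cdots a_{i_k})$$ (well-defined since $f$ is central; in particular $f_0()=1$ and $f_1=f$). The map $f_n$ is symmetric in its $n$ inputs. The maps $g_r$ and $h_n$ are the Frobenius maps defined in the same way from $g$ and $h$ (note that $h=f\circ g$ is central because $g$ is). For a finite set $J$, $\Pi_J$ denotes the set of all set partitions of $J$, i.e. sets $\{J_1,\ldots,J_k\}$ of disjoint nonempty subsets of $J$ (called blocks) whose union is $J$. In particular $\Pi_\varnothing=\{\varnothing\}$ (the unique partition of the empty set has $0$ blocks). *)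

theory Defs
  imports Complex_Main "HOL-Combinatorics.Permutations" "HOL-Library.Disjoint_Sets"
begin

text \<open>
  Unital rings are types of sort \<open>{ring, monoid_mult}\<close>, commutative ones of sort
  \<open>{comm_ring, comm_monoid_mult}\<close>. Unlike \<open>ring_1\<close> and \<open>comm_ring_1\<close>, these sorts do not
  include the axiom \<open>0 \<noteq> 1\<close>, so that zero rings are allowed.
  \<open>\<int>\<close>-linear maps are the homomorphisms of additive groups, i.e. the library's \<open>additive\<close> maps.
\<close>

definition central :: "('a::{ring, monoid_mult} \<Rightarrow> 'b::{comm_ring, comm_monoid_mult}) \<Rightarrow> bool"
  where "central f \<longleftrightarrow> (\<forall>x y. f (x * y) = f (y * x))"

definition cycle_tuple :: "nat \<Rightarrow> (nat \<Rightarrow> nat) \<Rightarrow> nat list \<Rightarrow> bool"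
  where "cycle_tuple n \<sigma> c \<longleftrightarrow>
    c \<noteq> [] \<and> distinct c \<and> set c \<subseteq> {1..n} \<and>
    (\<forall>j. Suc j < length c \<longrightarrow> \<sigma> (c ! j) = c ! Suc j) \<and> \<sigma> (last c) = hd c"

definition cycles :: "nat \<Rightarrow> (nat \<Rightarrow> nat) \<Rightarrow> nat list set set"
  where "cycles n \<sigma> = {c. cycle_tuple n \<sigma> c} // {(c, d). \<exists>m. d = rotate m c}"

definition cycle_value ::
    "('a::{ring, monoid_mult} \<Rightarrow> 'b::{comm_ring, comm_monoid_mult}) \<Rightarrow> (nat \<Rightarrow> 'a) \<Rightarrow> nat list \<Rightarrow> 'b"
  where "cycle_value f a c = f (prod_list (map a c))"

text \<open>
  The tuple \<open>(a\<^sub>1, \<dots>, a\<^sub>n)\<close> is given by a function on \<open>nat\<close>, of which only the values on \<open>{1..n}\<close>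
  matter. The sign is written out because \<open>of_int\<close> requires \<open>ring_1\<close>. The representative
  of a cycle is irrelevant if \<open>f\<close> is central, see \<open>cycle_value_some\<close> below.
\<close>

definition frobenius ::
    "('a::{ring, monoid_mult} \<Rightarrow> 'b::{comm_ring, comm_monoid_mult}) \<Rightarrow> nat \<Rightarrow> (nat \<Rightarrow> 'a) \<Rightarrow> 'b"
  where "frobenius f n a =
    (\<Sum>\<sigma> | \<sigma> permutes {1..n}.
       (if evenperm \<sigma> then 1 else - 1) * (\<Prod>C\<in>cycles n \<sigma>. cycle_value f a (SOME c. c \<in> C)))"

lemma cycle_value_rotate:
  assumes "central f"
  shows "cycle_value f a (rotate m c) = cycle_value f a c"
proof -
  have rotate1: "cycle_value f a (rotate1 d) = cycle_value f a d" for d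
    using assms by (cases d) (auto simp: cycle_value_def central_def)
  show ?thesis
    by (induction m) (simp_all add: rotate1)
qed

lemma cycle_value_some:
  assumes "central f" and "C \<in> cycles n \<sigma>" and "c \<in> C"
  shows "cycle_value f a (SOME c. c \<in> C) = cycle_value f a c"
proof -
  obtain d where C: "C = {(c, d). \<exists>m. d = rotate m c} `` {d}"
    using assms(2) unfolding cycles_def by (auto elim: quotientE)
  have "cycle_value f a e = cycle_value f a d" if "e \<in> C" for e
    using that C cycle_value_rotate[OF assms(1)] by auto
  then show ?thesis
    using assms(3) someI[of "\<lambda>c. c \<in> C" c] by simp
qed

lemma frobenius_0: "frobenius f 0 a = 1"
proof -
  have "cycles 0 id = {}"
    by (auto simp: cycles_def cycle_tuple_def)
  moreover have "{\<sigma>. \<sigma> permutes {1..0::nat}} = {id}"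
    by auto
  ultimately show ?thesis
    by (simp add: frobenius_def)
qed

lemma frobenius_1: "frobenius f 1 a = f (a 1)"
proof -
  have "cycle_tuple 1 id c \<longleftrightarrow> c = [1]" for c
  proof
    assume "cycle_tuple 1 id c"
    then have c: "c \<noteq> []" "distinct c" "set c \<subseteq> {1}"
      unfolding cycle_tuple_def atLeastAtMost_singleton by blast+
    then have "set c = {1}"
      by (metis set_empty subset_singletonD)
    moreover have "length c = 1"
      using distinct_card[OF c(2)] unfolding \<open>set c = {1}\<close> by simp
    ultimately show "c = [1]"
      by (cases c) auto
  qed (simp add: cycle_tuple_def)
  then have "{c. cycle_tuple 1 id c} = {[1]}"
    by (simp only: singleton_conv)
  moreover have "{(c, d). \<exists>m. d = rotate m c} `` {[1::nat]} = {[1]}"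
    by (simp add: rotate_length01 Image_singleton)
  ultimately have "cycles 1 id = {{[1]}}"
    by (simp only: cycles_def singleton_quotient)
  moreover have "{\<sigma>. \<sigma> permutes {1..1::nat}} = {id}"
    by auto
  ultimately show ?thesis
    by (simp add: frobenius_def cycle_value_def)
qed

end

theory Submission
  imports Defs
begin

text \<open>
  Splitting the permutations of \<open>insert x S\<close> by the successor of \<open>x\<close> shows that Frobenius maps
  satisfy the recursion
  \<open>f\<^bsub>insert x S\<^esub> a = f (a x) * f\<^bsub>S\<^esub> a - (\<Sum>b\<in>S. f\<^bsub>S\<^esub> (a(b := a x * a b)))\<close>.
  The formula for \<open>f \<circ> g\<close> follows by induction on the index set, since a partition of \<open>insert x S\<close>
  arises from a partition \<open>\<pi>\<close> of \<open>S\<close> by adding the block \<open>{x}\<close> or by adding \<open>x\<close> to a block \<open>P\<close>.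
  Expanding the first kind by the recursion for \<open>f\<close> and the second by the recursion for \<open>g\<close>, the
  terms in which \<open>b\<^sub>P\<close> is multiplied by \<open>g (a x)\<close> cancel, and the rest is the recursion for
  \<open>f \<circ> g\<close>.
\<close>

section \<open>Frobenius maps over arbitrary index sets\<close>

text \<open>
  Index sets are arbitrary, because the recursion removes any index and because the blocks of a
  partition serve as indices themselves.
\<close>

definition cycle_tuple_on :: "'i set \<Rightarrow> ('i \<Rightarrow> 'i) \<Rightarrow> 'i list \<Rightarrow> bool"
  where "cycle_tuple_on S \<sigma> c \<longleftrightarrow>
    c \<noteq> [] \<and> distinct c \<and> set c \<subseteq> S \<and>
    (\<forall>j. Suc j < length c \<longrightarrow> \<sigma> (c ! j) = c ! Suc j) \<and> \<sigma> (last c) = hd c"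

definition cycles_on :: "'i set \<Rightarrow> ('i \<Rightarrow> 'i) \<Rightarrow> 'i list set set"
  where "cycles_on S \<sigma> = {c. cycle_tuple_on S \<sigma> c} // {(c, d). \<exists>m. d = rotate m c}"

definition cycle_value_on ::
    "('a::{ring, monoid_mult} \<Rightarrow> 'b::{comm_ring, comm_monoid_mult}) \<Rightarrow> ('i \<Rightarrow> 'a) \<Rightarrow> 'i list \<Rightarrow> 'b"
  where "cycle_value_on f a c = f (prod_list (map a c))"

definition frobenius_on ::
    "('a::{ring, monoid_mult} \<Rightarrow> 'b::{comm_ring, comm_monoid_mult}) \<Rightarrow> 'i set \<Rightarrow> ('i \<Rightarrow> 'a) \<Rightarrow> 'b"
  where "frobenius_on f S a =
    (\<Sum>\<sigma> | \<sigma> permutes S.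
       (if evenperm \<sigma> then 1 else - 1) *
       (\<Prod>C\<in>cycles_on S \<sigma>. cycle_value_on f a (SOME c. c \<in> C)))"

lemma frobenius_eq_frobenius_on: "frobenius f n a = frobenius_on f {1..n} a"
proof -
  have "cycle_tuple n \<sigma> = cycle_tuple_on {1..n} \<sigma>" for \<sigma>
    by (simp add: fun_eq_iff cycle_tuple_def cycle_tuple_on_def)
  then have "cycles n \<sigma> = cycles_on {1..n} \<sigma>" for \<sigma>
    by (simp add: cycles_def cycles_on_def)
  then show ?thesis
    by (simp add: frobenius_def frobenius_on_def cycle_value_def cycle_value_on_def)
qed

section \<open>Cycle tuples up to rotation\<close>

lemma cycle_value_on_rotate:
  assumes "central f"
  shows "cycle_value_on f a (rotate m c) = cycle_value_on f a c"
proof -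
  have rotate1: "cycle_value_on f a (rotate1 d) = cycle_value_on f a d" for d
    using assms by (cases d) (auto simp: cycle_value_on_def central_def)
  show ?thesis
    by (induction m) (simp_all add: rotate1)
qed

text \<open>Repeating the first entry at the end turns the closing condition into one more successor
  condition, so a cycle becomes a closed walk that can be cut and extended as a list.\<close>

lemma cycle_tuple_on_Cons:
  "cycle_tuple_on S \<sigma> (x # c) \<longleftrightarrow>
    distinct (x # c) \<and> set (x # c) \<subseteq> S \<and> successively (\<lambda>y z. \<sigma> y = z) (x # c @ [x])"
proof -
  have "successively (\<lambda>y z. \<sigma> y = z) (d @ [x]) \<longleftrightarrow>
      (\<forall>j. Suc j < length d \<longrightarrow> \<sigma> (d ! j) = d ! Suc j) \<and> \<sigma> (last d) = x" if "d \<noteq> []" for d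
    using that by (simp add: successively_append_iff, simp add: successively_conv_nth)
  from this[of "x # c"] show ?thesis
    by (auto simp: cycle_tuple_on_def)
qed

lemma cycle_tuple_on_rotate1:
  assumes "cycle_tuple_on S \<sigma> c"
  shows "cycle_tuple_on S \<sigma> (rotate1 c)"
proof (cases c)
  case (Cons x d)
  show ?thesis
  proof (cases d)
    \<comment> \<open>Rotating drops the first step of the closed walk
      \<open>x # y # e @ [x]\<close> and appends the same step from \<open>x\<close> to
      \<open>y\<close> at the end.\<close>
    case (Cons y e)
    with \<open>c = x # d\<close> assms have "successively (\<lambda>y z. \<sigma> y = z) ((y # e @ [x]) @ [y])"
      by (subst successively_append_iff) (auto simp: cycle_tuple_on_Cons)
    with \<open>c = x # d\<close> Cons assms show ?thesis
      by (auto simp: cycle_tuple_on_Cons)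
  qed (use Cons assms in simp)
qed (use assms in simp)

lemma cycle_tuple_on_rotate: "cycle_tuple_on S \<sigma> c \<Longrightarrow> cycle_tuple_on S \<sigma> (rotate m c)"
  by (induction m) (simp_all add: cycle_tuple_on_rotate1)

text \<open>The tuple follows the orbit of its head; this is what makes the head determine it in
  \<open>cycle_tuple_on_eqI\<close>.\<close>

lemma cycle_tuple_on_nth:
  assumes "cycle_tuple_on S \<sigma> c" and "j < length c"
  shows "c ! j = (\<sigma> ^^ j) (hd c)"
  using assms(2)
proof (induction j)
  case 0
  then show ?case by (simp add: hd_conv_nth)
next
  case (Suc j)
  then show ?case using assms(1) by (auto simp: cycle_tuple_on_def)
qed

lemma cycle_tuple_on_period:
  assumes "cycle_tuple_on S \<sigma> c"
  shows "(\<sigma> ^^ length c) (hd c) = hd c"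
proof -
  have "c \<noteq> []" "\<sigma> (last c) = hd c"
    using assms by (auto simp: cycle_tuple_on_def)
  moreover have "last c = (\<sigma> ^^ (length c - 1)) (hd c)"
    using cycle_tuple_on_nth[OF assms, of "length c - 1"] \<open>c \<noteq> []\<close> by (simp add: last_conv_nth)
  ultimately show ?thesis
    by (metis Suc_diff_1 comp_apply funpow.simps(2) length_greater_0_conv)
qed

text \<open>If \<open>c\<close> were longer, its entry at position \<open>length d\<close> would, by
  the period of \<open>d\<close>, be the head again, against distinctness.\<close>

lemma cycle_tuple_on_length_le:
  assumes "cycle_tuple_on S \<sigma> c" "cycle_tuple_on S \<sigma> d" "hd c = hd d"
  shows "length c \<le> length d"
proof (rule ccontr)
  assume "\<not> length c \<le> length d"
  then have lt: "length d < length c" by simp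
  have c: "c \<noteq> []" "distinct c" and d: "d \<noteq> []"
    using assms by (auto simp: cycle_tuple_on_def)
  have "c ! length d = c ! 0"
    using cycle_tuple_on_nth[OF assms(1) lt] cycle_tuple_on_period[OF assms(2)] assms(3) c(1)
    by (simp add: hd_conv_nth)
  then show False
    using c d lt by (simp add: nth_eq_iff_index_eq)
qed

lemma cycle_tuple_on_eqI:
  assumes "cycle_tuple_on S \<sigma> c" "cycle_tuple_on S \<sigma> d" "hd c = hd d"
  shows "c = d"
proof (rule nth_equalityI)
  show "length c = length d"
    using cycle_tuple_on_length_le assms by (metis le_antisym)
  then show "c ! i = d ! i" if "i < length c" for i
    using that assms cycle_tuple_on_nth by metis
qed

lemma ex_rotate_hd:
  assumes "x \<in> set c"
  obtains m where "hd (rotate m c) = x"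
proof -
  obtain ys zs where "c = ys @ x # zs"
    using assms by (auto simp: in_set_conv_decomp)
  then have "hd (rotate (length ys) c) = x"
    by (simp add: rotate_append)
  then show thesis by (rule that)
qed

text \<open>A further rotation by \<open>length c - m mod length c\<close> completes full turns;
  this makes the rotation relation symmetric.\<close>

lemma rotate_inverse: "\<exists>k. rotate k (rotate m c) = c"
proof (cases "c = []")
  case False
  then have "(length c - m mod length c + m) mod length c = 0"
    by (metis le_add_diff_inverse2 length_greater_0_conv mod_add_right_eq mod_le_divisor mod_self)
  then have "rotate (length c - m mod length c) (rotate m c) = c"
    by (simp add: rotate_rotate rotate_id)
  then show ?thesis ..
qed simp

text \<open>Once both tuples are rotated to begin with \<open>x\<close>, they have the same head and
  hence coincide.\<close>

lemma cycle_tuple_on_rotation: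
  assumes "cycle_tuple_on S \<sigma> c" "cycle_tuple_on S \<sigma> d" "x \<in> set c" "x \<in> set d"
  shows "\<exists>m. d = rotate m c"
proof -
  obtain k l where "hd (rotate k c) = x" "hd (rotate l d) = x"
    using ex_rotate_hd assms(3,4) by metis
  then have "rotate k c = rotate l d"
    using assms(1,2) by (intro cycle_tuple_on_eqI[of S \<sigma>] cycle_tuple_on_rotate) simp_all
  then show ?thesis
    using rotate_inverse[of l d] by (metis rotate_rotate)
qed

section \<open>One tuple per cycle, and products over cycles\<close>

text \<open>A cycle system contains one tuple from each class of \<^const>\<open>cycles_on\<close>.\<close>

definition cycle_system :: "'i set \<Rightarrow> ('i \<Rightarrow> 'i) \<Rightarrow> 'i list set \<Rightarrow> bool"
  where "cycle_system S \<sigma> R \<longleftrightarrow>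
    (\<forall>c\<in>R. cycle_tuple_on S \<sigma> c) \<and>
    (\<forall>c\<in>R. \<forall>d\<in>R. c \<noteq> d \<longrightarrow> set c \<inter> set d = {}) \<and> (\<Union>c\<in>R. set c) = S"

lemma cycle_system_finite:
  assumes "cycle_system S \<sigma> R" "finite S"
  shows "finite R"
proof -
  have "R \<subseteq> {c. set c \<subseteq> S \<and> distinct c}"
    using assms by (auto simp: cycle_system_def cycle_tuple_on_def)
  then show ?thesis
    using finite_subset finite_subset_distinct[OF assms(2)] by blast
qed

text \<open>Each class of \<open>cycles_on\<close> meets \<open>R\<close> exactly once, and
  centrality makes the value independent of the tuple chosen in a class. Products over the quotient
  can thus be computed from explicit tuples.\<close>

lemma prod_cycles_on:
  fixes R :: "'i list set"
  assumes "central f" "cycle_system S \<sigma> R"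
  shows "(\<Prod>C\<in>cycles_on S \<sigma>. cycle_value_on f a (SOME c. c \<in> C)) = (\<Prod>c\<in>R. cycle_value_on f a c)"
proof -
  define rot where "rot = {(c, d :: 'i list). \<exists>m. d = rotate m c}"
  have cycles: "cycles_on S \<sigma> = {c. cycle_tuple_on S \<sigma> c} // rot"
    by (simp add: cycles_on_def rot_def)
  have self: "c \<in> rot `` {c}" for c
    unfolding rot_def by (auto intro: exI[of _ 0])
  have R: "cycle_tuple_on S \<sigma> c" if "c \<in> R" for c
    using assms(2) that by (auto simp: cycle_system_def)
  have "inj_on (\<lambda>c. rot `` {c}) R"
  proof (rule inj_onI)
    fix c d assume cd: "c \<in> R" "d \<in> R" "rot `` {c} = rot `` {d}"
    then have "d \<in> rot `` {c}" using self by simp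
    then have "set d = set c" by (auto simp: rot_def)
    moreover have "d \<noteq> []" using R[OF cd(2)] by (simp add: cycle_tuple_on_def)
    ultimately show "c = d"
      using assms(2) cd(1,2) unfolding cycle_system_def by (metis Int_absorb set_empty)
  qed
  moreover have "(\<lambda>c. rot `` {c}) ` R = cycles_on S \<sigma>"
  proof (intro equalityI subsetI)
    fix C assume "C \<in> (\<lambda>c. rot `` {c}) ` R"
    then show "C \<in> cycles_on S \<sigma>"
      using R unfolding cycles by (auto intro: quotientI)
  next
    fix C assume "C \<in> cycles_on S \<sigma>"
    then obtain d where d: "cycle_tuple_on S \<sigma> d" "C = rot `` {d}"
      unfolding cycles by (auto elim: quotientE)
    \<comment> \<open>Since \<open>R\<close> covers \<open>S\<close>, any entry of \<open>d\<close>
      lies in some \<open>c\<close> of \<open>R\<close>, and cycle tuples with a common entry are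
      rotations of each other.\<close>
    then obtain x where x: "x \<in> set d" "x \<in> S"
      by (metis cycle_tuple_on_def hd_in_set subsetD)
    then obtain c where c: "c \<in> R" "x \<in> set c"
      using assms(2) by (auto simp: cycle_system_def)
    obtain m where m: "d = rotate m c"
      using cycle_tuple_on_rotation[OF R[OF c(1)] d(1) c(2) x(1)] by blast
    obtain k where k: "rotate k d = c"
      using rotate_inverse m by blast
    have "rot `` {c} = rot `` {d}"
    proof (intro equalityI subsetI)
      fix e assume "e \<in> rot `` {c}"
      then obtain j where "e = rotate j c" by (auto simp: rot_def)
      then have "e = rotate (j + k) d" by (simp add: k[symmetric] rotate_rotate)
      then show "e \<in> rot `` {d}" by (auto simp: rot_def)
    next
      fix e assume "e \<in> rot `` {d}"
      then obtain j where "e = rotate j d" by (auto simp: rot_def)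
      then have "e = rotate (j + m) c" by (simp add: m rotate_rotate)
      then show "e \<in> rot `` {c}" by (auto simp: rot_def)
    qed
    then show "C \<in> (\<lambda>c. rot `` {c}) ` R" using c(1) d(2) by blast
  qed
  ultimately have "bij_betw (\<lambda>c. rot `` {c}) R (cycles_on S \<sigma>)"
    by (simp add: bij_betw_def)
  then have "(\<Prod>C\<in>cycles_on S \<sigma>. cycle_value_on f a (SOME c. c \<in> C)) =
      (\<Prod>c\<in>R. cycle_value_on f a (SOME d. d \<in> rot `` {c}))"
    by (rule prod.reindex_bij_betw[symmetric])
  also have "\<dots> = (\<Prod>c\<in>R. cycle_value_on f a c)"
  proof (rule prod.cong[OF refl])
    fix c
    have "(SOME d. d \<in> rot `` {c}) \<in> rot `` {c}" using self by (rule someI)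
    then show "cycle_value_on f a (SOME d. d \<in> rot `` {c}) = cycle_value_on f a c"
      using cycle_value_on_rotate[OF assms(1)] by (auto simp: rot_def)
  qed
  finally show ?thesis .
qed

section \<open>Inserting a new index into the cycles of a permutation\<close>

lemma cycle_tuple_on_cong:
  assumes "cycle_tuple_on S \<sigma> c" "\<And>y. y \<in> set c \<Longrightarrow> \<tau> y = \<sigma> y" "S \<subseteq> T"
  shows "cycle_tuple_on T \<tau> c"
  using assms by (auto simp: cycle_tuple_on_def)

lemma cycle_system_insert_fixpoint:
  assumes "cycle_system S q R" "q permutes S" "x \<notin> S"
  shows "cycle_system (insert x S) q (insert [x] R)" and "[x] \<notin> R"
proof -
  have "q x = x" using assms(2,3) by (simp add: permutes_not_in)
  then have "cycle_tuple_on (insert x S) q [x]" by (simp add: cycle_tuple_on_def)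
  moreover have x: "x \<notin> set c" if "c \<in> R" for c
    using that assms(1,3) by (auto simp: cycle_system_def)
  then have "[x] \<notin> R" by fastforce
  moreover have "cycle_tuple_on (insert x S) q c" if "c \<in> R" for c
    using that assms(1) cycle_tuple_on_cong[of S q c q "insert x S"] by (auto simp: cycle_system_def)
  ultimately show "cycle_system (insert x S) q (insert [x] R)" "[x] \<notin> R"
    using x assms(1) by (auto simp: cycle_system_def)
qed

text \<open>Rotating the cycle through \<open>b\<close> to begin with \<open>b\<close> prepares for
  placing a new index directly in front of \<open>b\<close>.\<close>

lemma cycle_system_starting_at:
  assumes "cycle_system S q R" "b \<in> S"
  obtains l R' where "cycle_system S q (insert (b # l) R')"
    and "\<And>c. c \<in> R' \<Longrightarrow> set c \<inter> set (b # l) = {}"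
proof -
  obtain c where c: "c \<in> R" "b \<in> set c"
    using assms by (auto simp: cycle_system_def)
  obtain m where m: "hd (rotate m c) = b"
    using ex_rotate_hd c(2) by metis
  have "rotate m c \<noteq> []" using c(2) by auto
  then obtain l where l: "rotate m c = b # l"
    using m by (cases "rotate m c") auto
  have set: "set (b # l) = set c" using l by (metis set_rotate)
  have tuple: "cycle_tuple_on S q (b # l)"
    using cycle_tuple_on_rotate[of S q c m] assms(1) c(1) l by (simp add: cycle_system_def)
  have disj: "set d \<inter> set (b # l) = {}" if "d \<in> R - {c}" for d
    using that assms(1) c(1) unfolding set cycle_system_def by blast
  have "(\<Union>d\<in>insert (b # l) (R - {c}). set d) = (\<Union>d\<in>R. set d)"
    using set c(1) by auto
  with tuple disj assms(1) have "cycle_system S q (insert (b # l) (R - {c}))"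
    unfolding cycle_system_def by (simp only: ball_simps) blast
  then show thesis using disj by (rule that)
qed

text \<open>As \<open>q\<close> fixes \<open>x\<close>, the new permutation sends \<open>x\<close>
  to \<open>b\<close>, while the predecessor of \<open>b\<close>, the last entry of
  \<open>b # l\<close>, is redirected to \<open>x\<close>. Thus \<open>x\<close> enters the cycle
  just before \<open>b\<close>.\<close>

lemma cycle_tuple_on_insert_transpose:
  assumes "cycle_tuple_on S q (b # l)" "q permutes S" "x \<notin> S"
  shows "cycle_tuple_on (insert x S) (transpose x b \<circ> q) (x # b # l)"
proof -
  let ?\<tau> = "transpose x b \<circ> q"
  have d: "distinct (b # l)" "set (b # l) \<subseteq> S" and s: "successively (\<lambda>y z. q y = z) ((b # l) @ [b])"
    using assms(1) by (simp_all add: cycle_tuple_on_Cons)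
  have "x \<notin> set (b # l)" using d assms(3) by blast
  have "?\<tau> x = b" using assms(2,3) by (simp add: permutes_not_in)
  moreover have "successively (\<lambda>y z. ?\<tau> y = z) (b # l)"
  proof -
    have "successively (\<lambda>y z. q y = z) (b # l)"
      using s by (simp only: successively_append_iff)
    then have "q ((b # l) ! j) = (b # l) ! Suc j" if "Suc j < length (b # l)" for j
      using that by (simp only: successively_conv_nth)
    \<comment> \<open>Steps inside \<open>b # l\<close> never land on \<open>b\<close> or
      \<open>x\<close>, so the transposition leaves them unchanged.\<close>
    moreover have "(b # l) ! Suc j \<noteq> b" "(b # l) ! Suc j \<noteq> x" if "Suc j < length (b # l)" for j
      using that d(1) \<open>x \<notin> set (b # l)\<close> by auto
    ultimately have "?\<tau> ((b # l) ! j) = (b # l) ! Suc j" if "Suc j < length (b # l)" for j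
      using that by (metis comp_apply transpose_apply_other)
    then show ?thesis by (simp only: successively_conv_nth) simp
  qed
  moreover have "?\<tau> (last (b # l)) = x"
    using s by (simp only: successively_append_iff) simp
  ultimately have "successively (\<lambda>y z. ?\<tau> y = z) (x # (b # l) @ [x])"
    by (simp only: successively_append_iff append_Cons[symmetric] successively.simps) simp
  then show ?thesis
    using d \<open>x \<notin> set (b # l)\<close> by (simp add: cycle_tuple_on_Cons subset_insertI2)
qed

text \<open>Only the cycle through \<open>b\<close> changes: the others contain neither
  \<open>x\<close> nor \<open>b\<close>, and \<open>q\<close> maps each of them into itself.\<close>

lemma cycle_system_insert_transpose:
  assumes "cycle_system S q (insert (b # l) R')" "q permutes S" "x \<notin> S"
    and disj: "\<And>c. c \<in> R' \<Longrightarrow> set c \<inter> set (b # l) = {}"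
  shows "cycle_system (insert x S) (transpose x b \<circ> q) (insert (x # b # l) R')"
proof -
  have bl: "cycle_tuple_on S q (b # l)" and R': "\<And>c. c \<in> R' \<Longrightarrow> cycle_tuple_on S q c"
    using assms(1) by (auto simp: cycle_system_def)
  have x: "x \<notin> set c" if "c \<in> R'" for c
    using R'[OF that] assms(3) by (auto simp: cycle_tuple_on_def)
  have tuple: "cycle_tuple_on (insert x S) (transpose x b \<circ> q) c" if "c \<in> R'" for c
  proof (rule cycle_tuple_on_cong[OF R'[OF that]])
    fix y assume y: "y \<in> set c"
    have "q y \<in> set c"
    proof -
      obtain j where j: "j < length c" "y = c ! j" using y by (auto simp: in_set_conv_nth)
      show ?thesis
      proof (cases "Suc j < length c")
        case True
        then show ?thesis using R'[OF that] j by (auto simp: cycle_tuple_on_def)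
      next
        case False
        then have "y = last c" using j by (metis Suc_lessI diff_Suc_1 last_conv_nth length_0_conv not_less_zero)
        then show ?thesis using R'[OF that] by (auto simp: cycle_tuple_on_def)
      qed
    qed
    then have "q y \<noteq> b" "q y \<noteq> x" using disj[OF that] x[OF that] by auto
    then show "(transpose x b \<circ> q) y = q y" by (simp add: transpose_apply_other)
  qed auto
  have "set c \<inter> set (x # b # l) = {}" if "c \<in> R'" for c
    using x[OF that] disj[OF that] by auto
  moreover have "\<forall>c\<in>R'. \<forall>d\<in>R'. c \<noteq> d \<longrightarrow> set c \<inter> set d = {}"
    using assms(1) by (simp add: cycle_system_def)
  ultimately have "\<forall>c\<in>insert (x # b # l) R'. \<forall>d\<in>insert (x # b # l) R'. c \<noteq> d \<longrightarrow> set c \<inter> set d = {}"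
    by (metis Int_commute insertE)
  moreover have "(\<Union>c\<in>insert (x # b # l) R'. set c) = insert x S"
    using assms(1) by (auto simp: cycle_system_def)
  moreover have "\<forall>c\<in>insert (x # b # l) R'. cycle_tuple_on (insert x S) (transpose x b \<circ> q) c"
    using tuple cycle_tuple_on_insert_transpose[OF bl assms(2,3)] by blast
  ultimately show ?thesis
    by (simp only: cycle_system_def)
qed

text \<open>A permutation of \<open>insert x S\<close> is \<open>transpose x b \<circ> q\<close>
  with \<open>q\<close> permuting \<open>S\<close>. For \<open>b = x\<close> the transposition is
  the identity and \<open>[x]\<close> is a new cycle; otherwise \<open>x\<close> joins the cycle of
  \<open>q\<close> through \<open>b\<close>.\<close>

lemma ex_cycle_system:
  assumes "finite S" "\<sigma> permutes S"
  shows "\<exists>R. cycle_system S \<sigma> R"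
  using assms
proof (induction S arbitrary: \<sigma>)
  case empty
  then show ?case by (auto intro: exI[of _ "{}"] simp: cycle_system_def)
next
  case (insert x S)
  obtain b q where b: "b \<in> insert x S" and q: "q permutes S" and \<sigma>: "\<sigma> = transpose x b \<circ> q"
    using insert.prems unfolding permutes_insert[of x S, unfolded set_eq_iff mem_Collect_eq, rule_format]
    by auto
  obtain R where R: "cycle_system S q R" using insert.IH q by blast
  show ?case
  proof (cases "b = x")
    case True
    then show ?thesis
      using cycle_system_insert_fixpoint(1)[OF R q insert.hyps(2)] \<sigma> by auto
  next
    case False
    then have "b \<in> S" using b by simp
    from cycle_system_starting_at[OF R this] obtain l R'
      where R': "cycle_system S q (insert (b # l) R')"
        and disj: "\<And>c. c \<in> R' \<Longrightarrow> set c \<inter> set (b # l) = {}"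
      by metis
    from cycle_system_insert_transpose[OF R' q insert.hyps(2) disj] show ?thesis
      unfolding \<sigma> by blast
  qed
qed

section \<open>The recursion for Frobenius maps\<close>

lemma frobenius_on_empty [simp]: "frobenius_on f ({} :: 'i set) a = 1"
proof -
  have "cycles_on ({} :: 'i set) id = {}"
    by (auto simp: cycles_on_def cycle_tuple_on_def)
  then show ?thesis
    by (simp add: frobenius_on_def permutes_empty)
qed

text \<open>The factorization \<open>transpose x b \<circ> q\<close> splits the sum. Permutations
  with \<open>b = x\<close> contribute the factor \<open>f (a x)\<close>. Those with
  \<open>b\<close> in \<open>S\<close> reverse the sign of \<open>q\<close> and put \<open>x\<close>
  before \<open>b\<close> in a cycle, which amounts to replacing \<open>a b\<close> by
  \<open>a x * a b\<close>.\<close>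

lemma frobenius_on_insert:
  fixes f :: "'a::{ring, monoid_mult} \<Rightarrow> 'b::{comm_ring, comm_monoid_mult}"
    and S :: "'i set"
  assumes "central f" "finite S" "x \<notin> S"
  shows "frobenius_on f (insert x S) a =
    f (a x) * frobenius_on f S a - (\<Sum>b\<in>S. frobenius_on f S (a(b := a x * a b)))"
proof -
  define sg :: "('i \<Rightarrow> 'i) \<Rightarrow> 'b" where "sg \<sigma> = (if evenperm \<sigma> then 1 else - 1)" for \<sigma>
  define V where "V T \<sigma> a = (\<Prod>C\<in>cycles_on T \<sigma>. cycle_value_on f a (SOME c. c \<in> C))"
    for T :: "'i set" and \<sigma> a
  have F: "frobenius_on f T a = (\<Sum>\<sigma> | \<sigma> permutes T. sg \<sigma> * V T \<sigma> a)" for T a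
    by (simp add: frobenius_on_def sg_def V_def)
  have V_fix: "V (insert x S) q a = f (a x) * V S q a" if q: "q permutes S" for q
  proof -
    obtain R where R: "cycle_system S q R" using ex_cycle_system assms(2) q by blast
    note R' = cycle_system_insert_fixpoint[OF R q assms(3)]
    show ?thesis
      using R'(2) cycle_system_finite[OF R assms(2)]
      unfolding V_def prod_cycles_on[OF assms(1) R] prod_cycles_on[OF assms(1) R'(1)]
      by (simp add: cycle_value_on_def)
  qed
  have V_transpose: "V (insert x S) (transpose x b \<circ> q) a = V S q (a(b := a x * a b))"
    if q: "q permutes S" and b: "b \<in> S" for q b
  proof -
    obtain R0 where "cycle_system S q R0" using ex_cycle_system assms(2) q by blast
    from cycle_system_starting_at[OF this b] obtain l R'
      where R: "cycle_system S q (insert (b # l) R')"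
        and disj: "\<And>c. c \<in> R' \<Longrightarrow> set c \<inter> set (b # l) = {}"
      by metis
    note R2 = cycle_system_insert_transpose[OF R q assms(3) disj]
    have fin: "finite R'" using cycle_system_finite[OF R assms(2)] by simp
    have notin: "b # l \<notin> R'" "x # b # l \<notin> R'" using disj by fastforce+
    have b_notin: "b \<notin> set c" if "c \<in> R'" for c using disj[OF that] by auto
    \<comment> \<open>Reading \<open>x # b # l\<close> with \<open>a\<close> gives the same product
      as reading \<open>b # l\<close> with the merged entry at \<open>b\<close>, because
      \<open>b\<close> occurs nowhere else.\<close>
    have "b \<notin> set l" using R by (auto simp: cycle_system_def cycle_tuple_on_def)
    then have "cycle_value_on f (a(b := a x * a b)) (b # l) = cycle_value_on f a (x # b # l)"
      by (simp add: cycle_value_on_def mult.assoc)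
    moreover have "cycle_value_on f (a(b := a x * a b)) c = cycle_value_on f a c" if "c \<in> R'" for c
      using b_notin[OF that] by (simp add: cycle_value_on_def)
    ultimately show ?thesis
      using fin notin
      by (simp add: V_def prod_cycles_on[OF assms(1) R] prod_cycles_on[OF assms(1) R2])
  qed
  have sg_transpose: "sg (transpose x b \<circ> q) = - sg q" if q: "q permutes S" and b: "b \<in> S" for q b
  proof -
    have "permutation q" using q assms(2) by (auto simp: permutation_permutes)
    moreover have "x \<noteq> b" using b assms(3) by auto
    ultimately show ?thesis
      by (simp add: sg_def evenperm_comp evenperm_swap permutation_swap_id)
  qed
  have "frobenius_on f (insert x S) a =
      (\<Sum>b\<in>insert x S. \<Sum>q | q permutes S.
        sg (transpose x b \<circ> q) * V (insert x S) (transpose x b \<circ> q) a)"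
    unfolding F using assms by (intro sum_over_permutations_insert)
  also have "\<dots> = (\<Sum>q | q permutes S. sg q * V (insert x S) q a) +
      (\<Sum>b\<in>S. \<Sum>q | q permutes S. sg (transpose x b \<circ> q) * V (insert x S) (transpose x b \<circ> q) a)"
    using assms by simp
  also have "(\<Sum>q | q permutes S. sg q * V (insert x S) q a) = f (a x) * frobenius_on f S a"
    by (simp add: F sum_distrib_left V_fix mult.left_commute)
  also have "(\<Sum>b\<in>S. \<Sum>q | q permutes S.
        sg (transpose x b \<circ> q) * V (insert x S) (transpose x b \<circ> q) a) =
      (\<Sum>b\<in>S. - frobenius_on f S (a(b := a x * a b)))"
    by (rule sum.cong) (simp_all add: F V_transpose sg_transpose sum_negf)
  finally show ?thesis by (simp add: sum_negf)
qed

section \<open>Locality, relabelling and multilinearity\<close>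

lemma frobenius_on_singleton:
  assumes "central f"
  shows "frobenius_on f {x} a = f (a x)"
  using frobenius_on_insert[OF assms, of "{}" x a] by simp

text \<open>The recursion evaluates \<open>a\<close> only at members of the index set; the induction
  keeps \<open>a\<close> arbitrary because the recursion alters it.\<close>

lemma frobenius_on_cong:
  assumes "central f" "finite S" "\<And>i. i \<in> S \<Longrightarrow> a i = a' i"
  shows "frobenius_on f S a = frobenius_on f S a'"
  using assms(2,3)
proof (induction S arbitrary: a a')
  case (insert x S)
  have "frobenius_on f S a = frobenius_on f S a'"
    using insert by (intro insert.IH) auto
  moreover have "frobenius_on f S (a(b := a x * a b)) = frobenius_on f S (a'(b := a' x * a' b))"
    if "b \<in> S" for b
    using insert.prems that by (intro insert.IH) auto
  moreover have "a x = a' x" using insert.prems by simp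
  ultimately show ?case
    unfolding frobenius_on_insert[OF assms(1) insert.hyps] by simp
qed simp

text \<open>An injective renaming carries the recursion over, since an update at \<open>p b\<close>
  pulls back to an update at \<open>b\<close> alone. For renamings of \<open>S\<close> onto itself
  this is the symmetry of Frobenius maps.\<close>

lemma frobenius_on_image:
  assumes "central f" "finite S" "inj_on p S"
  shows "frobenius_on f (p ` S) a = frobenius_on f S (\<lambda>i. a (p i))"
  using assms(2,3)
proof (induction S arbitrary: a)
  case (insert x S)
  then have p: "inj_on p S" "p x \<notin> p ` S" by auto
  have "frobenius_on f (p ` S) (a(p b := a (p x) * a (p b))) =
      frobenius_on f S ((\<lambda>i. a (p i))(b := a (p x) * a (p b)))" if "b \<in> S" for b
  proof -
    have "frobenius_on f (p ` S) (a(p b := a (p x) * a (p b))) =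
        frobenius_on f S (\<lambda>i. (a(p b := a (p x) * a (p b))) (p i))"
      using p by (intro insert.IH)
    also have "\<dots> = frobenius_on f S ((\<lambda>i. a (p i))(b := a (p x) * a (p b)))"
      using that p(1) insert.hyps(1)
      by (intro frobenius_on_cong[OF assms(1)]) (auto simp: inj_on_eq_iff)
    finally show ?thesis .
  qed
  moreover have "frobenius_on f (p ` S) a = frobenius_on f S (\<lambda>i. a (p i))"
    using p(1) by (rule insert.IH)
  moreover have "finite (p ` S)" using insert.hyps(1) by simp
  ultimately show ?case
    using p unfolding frobenius_on_insert[OF assms(1) insert.hyps] image_insert
    by (simp add: frobenius_on_insert[OF assms(1)] sum.reindex)
qed simp

text \<open>Induction along the recursion: the entry at \<open>i\<close> enters each term
  additively, whether \<open>i\<close> is the removed index \<open>x\<close>, the index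
  \<open>b\<close> merged with it, or neither.\<close>

lemma additive_frobenius_on:
  assumes "central f" "additive f" "finite S" "i \<in> S"
  shows "additive (\<lambda>u. frobenius_on f S (a(i := u)))"
  using assms(3,4)
proof (induction S arbitrary: a i)
  case (insert x S)
  note rec = frobenius_on_insert[OF assms(1) insert.hyps]
  have add_f: "f (u + v) = f u + f v" for u v
    using assms(2) by (rule additive.add)
  have IH: "frobenius_on f S (a(i := u + v)) = frobenius_on f S (a(i := u)) + frobenius_on f S (a(i := v))"
    if "i \<in> S" for a u v i
    using insert.IH[OF that] by (rule additive.add)
  define T where "T u b = frobenius_on f S ((a(i := u))(b := (a(i := u)) x * (a(i := u)) b))" for u b
  have T: "T (u + v) b = T u b + T v b" if b: "b \<in> S" for u v b
  proof (cases "i = x")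
    case True
    \<comment> \<open>The entry at \<open>x\<close> survives only as the left factor of the merged
      entry at \<open>b\<close>.\<close>
    have "T w b = frobenius_on f S (a(b := w * a b))" for w
      unfolding T_def using True insert.hyps b by (intro frobenius_on_cong[OF assms(1)]) auto
    then show ?thesis by (simp add: distrib_right IH[OF b])
  next
    case False
    then have i: "i \<in> S" using insert.prems by simp
    show ?thesis
    proof (cases "b = i")
      case True
      then show ?thesis
        using IH[OF i, of a "a x * u" "a x * v"] \<open>i \<noteq> x\<close> by (simp add: T_def distrib_left)
    next
      case False
      have "T w b = frobenius_on f S (a(b := a x * a b, i := w))" for w
        using \<open>i \<noteq> x\<close> False by (simp add: T_def fun_upd_twist[OF False])
      then show ?thesis by (simp add: IH[OF i])
    qed
  qed
  \<comment> \<open>Just one of the two factors depends on the entry at \<open>i\<close>: the first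
    if \<open>i = x\<close>, the second otherwise.\<close>
  have head: "f ((a(i := u + v)) x) * frobenius_on f S (a(i := u + v)) =
      f ((a(i := u)) x) * frobenius_on f S (a(i := u)) +
      f ((a(i := v)) x) * frobenius_on f S (a(i := v))" for u v
  proof (cases "i = x")
    case True
    have "frobenius_on f S (a(i := w)) = frobenius_on f S a" for w
      using True insert.hyps by (intro frobenius_on_cong[OF assms(1)]) auto
    then show ?thesis using True by (simp add: add_f distrib_right)
  next
    case False
    then show ?thesis using insert.prems by (simp add: IH distrib_left)
  qed
  have "(\<Sum>b\<in>S. T (u + v) b) = (\<Sum>b\<in>S. T u b) + (\<Sum>b\<in>S. T v b)" for u v
    by (simp add: T sum.distrib)
  then show ?case
    unfolding additive_def rec head T_def by simp
qed simp

section \<open>Set partitions after adding one element\<close>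

text \<open>The case \<open>P = {}\<close> accounts for the partitions in which \<open>{x}\<close> is a block.\<close>

lemma sum_partition_on_insert:
  assumes "finite S" "x \<notin> S"
  shows "(\<Sum>\<rho> | partition_on (insert x S) \<rho>. F \<rho>) =
    (\<Sum>\<pi> | partition_on S \<pi>. \<Sum>P\<in>insert {} \<pi>. F (insert (insert x P) (\<pi> - {P})))"
proof -
  let ?I = "SIGMA \<pi>:{\<pi>. partition_on S \<pi>}. insert {} \<pi>"
  let ?ins = "\<lambda>(\<pi>, P). insert (insert x P) (\<pi> - {P})"
  have "bij_betw ?ins ?I {\<rho>. partition_on (insert x S) \<rho>}"
    unfolding bij_betw_def
  proof
    have x: "x \<notin> Q" if "partition_on S \<pi>" "Q \<in> \<pi>" for \<pi> Q
      using that assms(2) by (auto simp: partition_on_def)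
    \<comment> \<open>The only block containing \<open>x\<close> reveals \<open>P\<close>, and the
      blocks avoiding \<open>x\<close> reveal \<open>\<pi> - {P}\<close>.\<close>
    have recover: "P = Q" "\<pi> - {P} = \<rho> - {Q}"
      if "(\<pi>, P) \<in> ?I" "(\<rho>, Q) \<in> ?I" "?ins (\<pi>, P) = ?ins (\<rho>, Q)" for \<pi> P \<rho> Q
    proof -
      have xP: "x \<notin> P" and x\<pi>: "\<And>B. B \<in> \<pi> \<Longrightarrow> x \<notin> B" using that(1) x by auto
      have xQ: "x \<notin> Q" and x\<rho>: "\<And>B. B \<in> \<rho> \<Longrightarrow> x \<notin> B" using that(2) x by auto
      have eq: "insert (insert x P) (\<pi> - {P}) = insert (insert x Q) (\<rho> - {Q})" using that(3) by simp
      have "{B \<in> insert (insert x P) (\<pi> - {P}). x \<in> B} = {insert x P}" using x\<pi> by auto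
      moreover have "{B \<in> insert (insert x Q) (\<rho> - {Q}). x \<in> B} = {insert x Q}" using x\<rho> by auto
      ultimately have "insert x P = insert x Q" using eq by simp
      then show "P = Q" using xP xQ by (simp add: insert_ident)
      have "{B \<in> insert (insert x P) (\<pi> - {P}). x \<notin> B} = \<pi> - {P}" using x\<pi> by auto
      moreover have "{B \<in> insert (insert x Q) (\<rho> - {Q}). x \<notin> B} = \<rho> - {Q}" using x\<rho> by auto
      ultimately show "\<pi> - {P} = \<rho> - {Q}" using eq by simp
    qed
    show "inj_on ?ins ?I"
    proof (rule inj_onI)
      fix s t assume st: "s \<in> ?I" "t \<in> ?I" "?ins s = ?ins t"
      obtain \<pi> P \<rho> Q where s: "s = (\<pi>, P)" and t: "t = (\<rho>, Q)" by fastforce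
      note r = recover[OF st[unfolded s t]]
      \<comment> \<open>Whether \<open>P\<close> must be put back is read off from \<open>P\<close>
        itself, since no block is empty.\<close>
      have "P \<in> \<pi> \<longleftrightarrow> P \<noteq> {}" "Q \<in> \<rho> \<longleftrightarrow> Q \<noteq> {}"
        using st(1,2) by (auto simp: s t partition_on_def)
      then have "\<pi> = \<rho>" using r by blast
      then show "s = t" using r(1) s t by simp
    qed
    show "?ins ` ?I = {\<rho>. partition_on (insert x S) \<rho>}"
    proof (intro equalityI subsetI)
      fix \<rho> assume "\<rho> \<in> ?ins ` ?I"
      then obtain \<pi> P where \<pi>: "partition_on S \<pi>" and P: "P \<in> insert {} \<pi>"
          and \<rho>: "\<rho> = insert (insert x P) (\<pi> - {P})" by auto
      have disj: "A \<inter> B = {}" if "A \<in> \<pi>" "B \<in> \<pi>" "A \<noteq> B" for A B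
        using \<pi> that by (auto simp: partition_on_def disjoint_def)
      have "\<Union>\<rho> = insert x S"
        using \<pi> P unfolding \<rho> by (auto simp: partition_on_def)
      moreover have "disjoint \<rho>"
        using x[OF \<pi>] P disj unfolding \<rho> disjoint_def by auto
      moreover have "{} \<notin> \<rho>" using \<pi> unfolding \<rho> by (auto simp: partition_on_def)
      ultimately show "\<rho> \<in> {\<rho>. partition_on (insert x S) \<rho>}" by (simp add: partition_on_def)
    next
      fix \<rho> assume "\<rho> \<in> {\<rho>. partition_on (insert x S) \<rho>}"
      then have \<rho>: "\<Union>\<rho> = insert x S" "{} \<notin> \<rho>"
          and disj: "\<And>A B. A \<in> \<rho> \<Longrightarrow> B \<in> \<rho> \<Longrightarrow> A \<noteq> B \<Longrightarrow> A \<inter> B = {}"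
        by (auto simp: partition_on_def disjoint_def)
      obtain B where B: "B \<in> \<rho>" "x \<in> B" using \<rho>(1) by blast
      define P where "P = B - {x}"
      \<comment> \<open>If \<open>B = {x}\<close>, then \<open>P\<close> is empty and must not
        become a block.\<close>
      define \<pi> where "\<pi> = (\<rho> - {B}) \<union> ({P} - {{}})"
      have B_P: "B = insert x P" "x \<notin> P" using B by (auto simp: P_def)
      have other: "A \<inter> B = {}" if "A \<in> \<rho> - {B}" for A using disj that B(1) by blast
      have "x \<notin> A" if "A \<in> \<rho> - {B}" for A using other[OF that] B(2) by blast
      moreover have \<pi>_Union: "\<Union>\<pi> = \<Union>(\<rho> - {B}) \<union> P" unfolding \<pi>_def by auto
      ultimately have "x \<notin> \<Union>\<pi>" using B_P(2) by blast
      moreover have "insert x (\<Union>\<pi>) = insert x S"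
        unfolding \<pi>_Union \<rho>(1)[symmetric] using B(1) B_P(1) by auto
      ultimately have "\<Union>\<pi> = S" using assms(2) by (simp add: insert_ident)
      moreover have "disjoint \<pi>"
        using disj other B_P(1) unfolding \<pi>_def disjoint_def by auto
      moreover have "{} \<notin> \<pi>" using \<rho>(2) unfolding \<pi>_def by auto
      ultimately have "partition_on S \<pi>" by (simp add: partition_on_def)
      moreover have "P \<in> insert {} \<pi>" unfolding \<pi>_def by auto
      moreover have "\<rho> = insert (insert x P) (\<pi> - {P})"
      proof -
        \<comment> \<open>A block other than \<open>B\<close> equal to \<open>P\<close> would lie
          inside \<open>B\<close> and yet be disjoint from it, so it would be empty.\<close>
        have "P \<notin> \<rho> - {B}" using other[of P] \<rho>(2) B_P by auto
        then have "\<pi> - {P} = \<rho> - {B}" unfolding \<pi>_def by auto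
        then show ?thesis using B(1) B_P(1) by auto
      qed
      ultimately show "\<rho> \<in> ?ins ` ?I" by (intro image_eqI[of _ _ "(\<pi>, P)"]) auto
    qed
  qed
  then have "(\<Sum>\<rho> | partition_on (insert x S) \<rho>. F \<rho>) = (\<Sum>s\<in>?I. F (?ins s))"
    by (rule sum.reindex_bij_betw[symmetric])
  also have "\<dots> = (\<Sum>\<pi> | partition_on S \<pi>. \<Sum>P\<in>insert {} \<pi>. F (insert (insert x P) (\<pi> - {P})))"
    using assms(1) finitely_many_partition_on[OF assms(1)]
    by (subst sum.Sigma) (auto intro: finite_elements simp: split_def)
  finally show ?thesis .
qed

section \<open>The Frobenius map of a composition\<close>

lemma frobenius_on_comp:
  fixes g :: "'a::{ring, monoid_mult} \<Rightarrow> 'b::{comm_ring, comm_monoid_mult}"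
    and f :: "'b \<Rightarrow> 'c::{comm_ring, comm_monoid_mult}"
    and S :: "'i set"
  assumes g: "central g" and f: "central f" "additive f" and S: "finite S"
  shows "frobenius_on (f \<circ> g) S a =
    (\<Sum>\<pi> | partition_on S \<pi>. frobenius_on f \<pi> (\<lambda>P. frobenius_on g P a))"
  using S
proof (induction S arbitrary: a)
  case empty
  have "{\<pi>. partition_on {} \<pi>} = {{} :: 'i set set}" by (auto simp: partition_on_empty)
  then show ?case by simp
next
  case (insert x S)
  \<comment> \<open>The values b_P, with the tuple kept as an argument because the recursion changes
    it.\<close>
  define \<beta> where "\<beta> = (\<lambda>(a :: 'i \<Rightarrow> 'a) P. frobenius_on g P a)"
  have IH: "frobenius_on (f \<circ> g) S a = (\<Sum>\<pi> | partition_on S \<pi>. frobenius_on f \<pi> (\<beta> a))" for a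
    unfolding \<beta>_def by (rule insert.IH)
  \<comment> \<open>Here all partitions of \<open>insert x S\<close> that induce
    \<open>\<pi>\<close> on \<open>S\<close> are collected, so the cancellation takes place
    separately for each \<open>\<pi>\<close>.\<close>
  have summand: "(\<Sum>P\<in>insert {} \<pi>. frobenius_on f (insert (insert x P) (\<pi> - {P})) (\<beta> a)) =
      f (g (a x)) * frobenius_on f \<pi> (\<beta> a) -
      (\<Sum>i\<in>S. frobenius_on f \<pi> (\<beta> (a(i := a x * a i))))"
    if \<pi>: "partition_on S \<pi>" for \<pi>
  proof -
    have fin: "finite \<pi>" using \<pi> insert.hyps(1) by (simp add: finite_elements)
    have ne: "{} \<notin> \<pi>" using \<pi> by (simp add: partition_on_def)
    have finP: "finite P" and xP: "x \<notin> P" if "P \<in> \<pi>" for P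
      using that \<pi> insert.hyps by (auto simp: partition_on_def intro: finite_subset)
    have old: "frobenius_on f (insert (insert x P) (\<pi> - {P})) (\<beta> a) =
        frobenius_on f \<pi> ((\<beta> a)(P := g (a x) * \<beta> a P)) -
        (\<Sum>i\<in>P. frobenius_on f \<pi> (\<beta> (a(i := a x * a i))))" if P: "P \<in> \<pi>" for P
    proof -
      interpret additive "\<lambda>u. frobenius_on f \<pi> ((\<beta> a)(P := u))"
        using f fin P by (rule additive_frobenius_on)
      \<comment> \<open>Renaming the block \<open>insert x P\<close> back to \<open>P\<close> turns
        the enlarged block into a change of one entry over the same index set \<open>\<pi>\<close>,
        where additivity applies.\<close>
      let ?p = "\<lambda>Q. if Q = P then insert x P else Q"
      have im: "?p ` \<pi> = insert (insert x P) (\<pi> - {P})" using P by auto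
      have "inj_on ?p \<pi>" using xP by (auto simp: inj_on_def split: if_splits)
      then have "frobenius_on f (insert (insert x P) (\<pi> - {P})) (\<beta> a) =
          frobenius_on f \<pi> (\<lambda>Q. \<beta> a (?p Q))"
        unfolding im[symmetric] by (rule frobenius_on_image[OF f(1) fin])
      also have "\<dots> = frobenius_on f \<pi> ((\<beta> a)(P := \<beta> a (insert x P)))"
        by (rule frobenius_on_cong[OF f(1) fin]) simp
      also have "\<beta> a (insert x P) = g (a x) * \<beta> a P - (\<Sum>i\<in>P. \<beta> (a(i := a x * a i)) P)"
        unfolding \<beta>_def using finP[OF P] xP[OF P] by (rule frobenius_on_insert[OF g])
      finally have "frobenius_on f (insert (insert x P) (\<pi> - {P})) (\<beta> a) =
          frobenius_on f \<pi> ((\<beta> a)(P := g (a x) * \<beta> a P)) -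
          (\<Sum>i\<in>P. frobenius_on f \<pi> ((\<beta> a)(P := \<beta> (a(i := a x * a i)) P)))"
        by (simp only: diff sum)
      \<comment> \<open>Among the blocks of \<open>\<pi>\<close>, only \<open>P\<close> contains
        \<open>i\<close>, so changing \<open>a\<close> at \<open>i\<close> alters
        \<open>\<beta> a\<close> only at \<open>P\<close>.\<close>
      also have "(\<Sum>i\<in>P. frobenius_on f \<pi> ((\<beta> a)(P := \<beta> (a(i := a x * a i)) P))) =
          (\<Sum>i\<in>P. frobenius_on f \<pi> (\<beta> (a(i := a x * a i))))"
      proof (intro sum.cong[OF refl] frobenius_on_cong[OF f(1) fin])
        fix i Q assume i: "i \<in> P" and Q: "Q \<in> \<pi>"
        show "((\<beta> a)(P := \<beta> (a(i := a x * a i)) P)) Q = \<beta> (a(i := a x * a i)) Q"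
        proof (cases "Q = P")
          case False
          then have "i \<notin> Q" using \<pi> P Q i by (auto simp: partition_on_def disjoint_def)
          then have "\<beta> a Q = \<beta> (a(i := a x * a i)) Q"
            unfolding \<beta>_def by (intro frobenius_on_cong[OF g(1) finP[OF Q]]) auto
          then show ?thesis using False by simp
        qed simp
      qed
      finally show ?thesis .
    qed
    have new: "frobenius_on f (insert {x} \<pi>) (\<beta> a) = f (g (a x)) * frobenius_on f \<pi> (\<beta> a) -
        (\<Sum>P\<in>\<pi>. frobenius_on f \<pi> ((\<beta> a)(P := g (a x) * \<beta> a P)))"
    proof -
      have "{x} \<notin> \<pi>" using xP by auto
      moreover have "\<beta> a {x} = g (a x)" unfolding \<beta>_def by (rule frobenius_on_singleton[OF g])
      ultimately show ?thesis using frobenius_on_insert[OF f(1) fin, of "{x}" "\<beta> a"] by simp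
    qed
    have "(\<Sum>P\<in>\<pi>. \<Sum>i\<in>P. frobenius_on f \<pi> (\<beta> (a(i := a x * a i)))) =
        (\<Sum>i\<in>\<Union>\<pi>. frobenius_on f \<pi> (\<beta> (a(i := a x * a i))))"
      using \<pi> finP by (subst sum.Union_disjoint) (auto simp: partition_on_def disjoint_def)
    also have "\<Union>\<pi> = S" using \<pi> by (simp add: partition_on_def)
    finally have swap: "(\<Sum>P\<in>\<pi>. \<Sum>i\<in>P. frobenius_on f \<pi> (\<beta> (a(i := a x * a i)))) =
        (\<Sum>i\<in>S. frobenius_on f \<pi> (\<beta> (a(i := a x * a i))))" .
    \<comment> \<open>As \<open>{}\<close> is no block of \<open>\<pi>\<close>, the sum splits into
      \<open>new\<close> for \<open>P = {}\<close> and \<open>old\<close> for the blocks.\<close>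
    show ?thesis
      using ne fin by (simp add: old new sum_subtractf swap)
  qed
  have "(\<Sum>\<pi> | partition_on (insert x S) \<pi>. frobenius_on f \<pi> (\<beta> a)) =
      (\<Sum>\<pi> | partition_on S \<pi>. f (g (a x)) * frobenius_on f \<pi> (\<beta> a) -
        (\<Sum>i\<in>S. frobenius_on f \<pi> (\<beta> (a(i := a x * a i)))))"
    unfolding sum_partition_on_insert[OF insert.hyps] by (rule sum.cong) (use summand in blast)+
  also have "\<dots> = f (g (a x)) * (\<Sum>\<pi> | partition_on S \<pi>. frobenius_on f \<pi> (\<beta> a)) -
      (\<Sum>i\<in>S. \<Sum>\<pi> | partition_on S \<pi>. frobenius_on f \<pi> (\<beta> (a(i := a x * a i))))"
    by (simp add: sum_subtractf sum_distrib_left) (rule sum.swap)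
  also have "\<dots> = (f \<circ> g) (a x) * frobenius_on (f \<circ> g) S a -
      (\<Sum>i\<in>S. frobenius_on (f \<circ> g) S (a(i := a x * a i)))"
    by (simp add: IH)
  also have "\<dots> = frobenius_on (f \<circ> g) (insert x S) a"
    using g insert.hyps by (intro frobenius_on_insert[symmetric]) (simp_all add: central_def)
  finally show ?case unfolding \<beta>_def ..
qed

section \<open>Passage to labelled subsets and labelled blocks\<close>

lemma frobenius_labelling:
  assumes "central f" "bij_betw p {1..card P} P"
  shows "frobenius f (card P) (\<lambda>i. a (p i)) = frobenius_on f P a"
  using frobenius_on_image[OF assms(1), of "{1..card P}" p a] assms(2)
  by (simp add: frobenius_eq_frobenius_on bij_betw_def)

theorem theorem0p11:
  fixes g :: "'a::{ring, monoid_mult} \<Rightarrow> 'b::{comm_ring, comm_monoid_mult}"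
    and f :: "'b \<Rightarrow> 'c::{comm_ring, comm_monoid_mult}"
    and h :: "'a \<Rightarrow> 'c"
    and n :: nat
    and a :: "nat \<Rightarrow> 'a"
    and b :: "nat set \<Rightarrow> 'b"
    and p :: "nat set \<Rightarrow> nat \<Rightarrow> nat"
    and q :: "nat set set \<Rightarrow> nat \<Rightarrow> nat set"
  assumes "additive g" and "central g"
    and "additive f" and "central f"
    and "h = f \<circ> g"
    and labelling_of_subsets: "\<And>P. P \<subseteq> {1..n} \<Longrightarrow> bij_betw (p P) {1..card P} P"
    and b: "\<And>P. P \<subseteq> {1..n} \<Longrightarrow> b P = frobenius g (card P) (\<lambda>i. a (p P i))"
    and labelling_of_blocks:
      "\<And>\<pi>. partition_on {1..n} \<pi> \<Longrightarrow> bij_betw (q \<pi>) {1..card \<pi>} \<pi>"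
  shows "frobenius h n a =
    (\<Sum>\<pi> | partition_on {1..n} \<pi>. frobenius f (card \<pi>) (\<lambda>i. b (q \<pi> i)))"
proof -
  \<comment> \<open>Both labellings disappear by renaming: \<open>q \<pi>\<close> lists the blocks
    and \<open>p P\<close> the elements of a block. The outer Frobenius map reads \<open>b\<close>
    only on blocks of \<open>\<pi>\<close>, which are subsets of \<open>{1..n}\<close>.\<close>
  have "frobenius f (card \<pi>) (\<lambda>i. b (q \<pi> i)) = frobenius_on f \<pi> (\<lambda>P. frobenius_on g P a)"
    if \<pi>: "partition_on {1..n} \<pi>" for \<pi>
  proof -
    have "finite \<pi>" by (rule finite_elements[OF finite_atLeastAtMost \<pi>])
    moreover have "b P = frobenius_on g P a" if "P \<in> \<pi>" for P
    proof -
      have "P \<subseteq> {1..n}" using that \<pi> by (auto simp: partition_on_def)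
      then show ?thesis
        using b frobenius_labelling[OF assms(2) labelling_of_subsets] by simp
    qed
    ultimately show ?thesis
      unfolding frobenius_labelling[OF assms(4) labelling_of_blocks[OF \<pi>]]
      by (intro frobenius_on_cong[OF assms(4)])
  qed
  then show ?thesis
    unfolding \<open>h = f \<circ> g\<close> frobenius_eq_frobenius_on[of "f \<circ> g"]
      frobenius_on_comp[OF assms(2,4,3) finite_atLeastAtMost]
    by simp
qed

end
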